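(* Let $G$ be a connected graph and $k \ge 3$. Then $F(G \,\square\, K_k) = \alpha(G \,\square\, K_k)$. In particular, $F(G \,\square\, K_k) = |V(G)|$ when $k \ge \chi(G)$.
   Context: Peg solitaire on a graph: a configuration assigns to each vertex either a peg or a hole. If $x,y,z$ form a path $xyz$ with pegs at $x$ and $y$ and a hole at $z$, a jump $xyz$ removes the pegs at $x$ and $y$ and places a peg at $z$. A terminal state of a graph $G$ is the set of peg locations when no jump is available, reached by some sequence of jumps from a starting configuration with exactly one hole (and pegs on all other vertices). The fool's solitaire number $F(G)$ is the maximum size of a terminal state of $G$. $\alpha$ is the independence number and $\chi$ the chromatic number. The cartesian product $G \,\square\, H$ has vertex set $V(G)\times V(H)$, two vertices being adjacent iff they are equal in one coordinate and adjacent in the other. *)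

theory Defs
  imports "Graph_Theory.Graph_Theory"
begin

text \<open>
  Finite simple graphs are modelled by the locale \<^locale>\<open>pair_graph\<close>: finite, symmetric,
  loop-free digraphs without parallel arcs. Each edge occurs in \<^const>\<open>parcs\<close> in both orientations.
\<close>

definition cartesian_product ::
    "'a pair_pre_digraph \<Rightarrow> 'b pair_pre_digraph \<Rightarrow> ('a \<times> 'b) pair_pre_digraph"
    (infixr \<open>\<box>\<close> 80) where
  "G \<box> H = \<lparr>
     pverts = pverts G \<times> pverts H,
     parcs = {((u, x), (v, y)) | u x v y.
       u = v \<and> u \<in> pverts G \<and> (x, y) \<in> parcs H \<or>
       x = y \<and> x \<in> pverts H \<and> (u, v) \<in> parcs G}\<rparr>"

definition independent_set :: "'a pair_pre_digraph \<Rightarrow> 'a set \<Rightarrow> bool" where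
  "independent_set G S \<longleftrightarrow> S \<subseteq> pverts G \<and> (\<forall>u\<in>S. \<forall>v\<in>S. (u, v) \<notin> parcs G)"

definition independence_number :: "'a pair_pre_digraph \<Rightarrow> nat" where
  "independence_number G = Max {card S | S. independent_set G S}"

definition proper_coloring :: "'a pair_pre_digraph \<Rightarrow> nat \<Rightarrow> ('a \<Rightarrow> nat) \<Rightarrow> bool" where
  "proper_coloring G n c \<longleftrightarrow>
     (\<forall>v\<in>pverts G. c v < n) \<and> (\<forall>(u, v)\<in>parcs G. c u \<noteq> c v)"

definition chromatic_number :: "'a pair_pre_digraph \<Rightarrow> nat" where
  "chromatic_number G = (LEAST n. \<exists>c. proper_coloring G n c)"

text \<open>
  A configuration is given by its set of pegs; all other vertices are holes. The path \<open>xyz\<close>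
  in a jump need not be induced: \<open>x\<close> and \<open>z\<close> may be adjacent.
\<close>

definition jump :: "'a pair_pre_digraph \<Rightarrow> 'a set \<Rightarrow> 'a set \<Rightarrow> bool" where
  "jump G S T \<longleftrightarrow> (\<exists>x y z. distinct [x, y, z] \<and> (x, y) \<in> parcs G \<and> (y, z) \<in> parcs G \<and>
     x \<in> S \<and> y \<in> S \<and> z \<notin> S \<and> T = insert z (S - {x, y}))"

definition terminal_state :: "'a pair_pre_digraph \<Rightarrow> 'a set \<Rightarrow> bool" where
  "terminal_state G T \<longleftrightarrow>
     (\<exists>v\<in>pverts G. (jump G)\<^sup>*\<^sup>* (pverts G - {v}) T) \<and> (\<nexists>T'. jump G T T')"

definition fools_solitaire_number :: "'a pair_pre_digraph \<Rightarrow> nat" where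
  "fools_solitaire_number G = Max {card T | T. terminal_state G T}"

end

theory Submission
  imports Defs
begin

text \<open>
  Reversing a play swaps pegs and holes: \<open>S\<close> is reachable from the complement of a single vertex
  \<open>v\<close> iff \<open>{v}\<close> is reachable from the complement of \<open>S\<close>. If \<open>S\<close> is a nonempty independent set of
  \<open>G \<box> K\<^sub>k\<close>, every copy of \<open>K\<^sub>k\<close> has at most one hole in the complement of \<open>S\<close>, and some copy has
  one. A jump \<open>(u,a), (v,a), (v,b)\<close> into the hole \<open>b\<close> of the copy at \<open>v\<close> removes a peg from
  the copy at \<open>u\<close> and keeps exactly one hole in the copy at \<open>v\<close>. Such jumps first give every copy
  exactly one hole and then, as \<open>k \<ge> 3\<close>, empty the copies one by one in an order in which each
  copy is adjacent to one that remains. The last copy is reduced to one peg inside \<open>K\<^sub>k\<close>.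
  Conversely, a terminal state with two adjacent pegs would have a peg on every vertex, as pegs
  propagate along the edges of a connected graph.
\<close>

section \<open>Induction along a connected graph\<close>

text \<open>Symmetry of the arcs turns connectedness into strong connectedness, so each vertex is
  reached from \<open>r\<close> by a directed walk along which membership in \<open>X\<close>
  propagates.\<close>

lemma connected_adjacency_closed:
  assumes "pair_graph G" "connected (with_proj G)" "r \<in> pverts G" "r \<in> X"
    and step: "\<And>u v. u \<in> X \<Longrightarrow> (u, v) \<in> parcs G \<Longrightarrow> v \<in> X"
  shows "pverts G \<subseteq> X"
proof
  interpret pair_graph G by fact
  have sc: "strongly_connected (with_proj G)"
    using assms(2) sym_arcs by (intro symmetric_connected_imp_strongly_connected)
  fix v assume "v \<in> pverts G"
  then have "r \<rightarrow>\<^sup>*\<^bsub>with_proj G\<^esub> v"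
    using sc assms(3) by (auto simp: strongly_connected_def)
  then show "v \<in> X"
    by (induction rule: reachable_induct) (use assms(4) step in auto)
qed

text \<open>By finiteness there is an inclusion-maximal \<open>W\<close> that contains
  \<open>r\<close> and satisfies \<open>P\<close>. An edge leaving \<open>W\<close> would let
  \<open>grow\<close> enlarge it, so \<open>W\<close> is closed under adjacency and is all of
  V(G).\<close>

lemma connected_growth_induct [consumes 3, case_names root grow]:
  assumes "pair_graph G" "connected (with_proj G)" "r \<in> pverts G"
    and root: "P {r}"
    and grow: "\<And>W u v. \<lbrakk>W \<subseteq> pverts G; v \<in> W; u \<in> pverts G - W; (v, u) \<in> parcs G; P W\<rbrakk>
                \<Longrightarrow> P (insert u W)"
  shows "P (pverts G)"
proof -
  interpret pair_graph G by fact
  have fin: "finite {W. W \<subseteq> pverts G \<and> r \<in> W \<and> P W}"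
    by (rule finite_subset[of _ "Pow (pverts G)"]) (auto simp: pair_finite_verts)
  have "{r} \<in> {W. W \<subseteq> pverts G \<and> r \<in> W \<and> P W}"
    using assms(3) root by auto
  then obtain W where W: "W \<subseteq> pverts G" "r \<in> W" "P W"
    and max: "\<And>X. X \<subseteq> pverts G \<Longrightarrow> r \<in> X \<Longrightarrow> P X \<Longrightarrow> W \<subseteq> X \<Longrightarrow> X = W"
    using finite_has_maximal2[OF fin] by (metis (mono_tags, lifting) mem_Collect_eq)
  have "v \<in> W" if "u \<in> W" "(u, v) \<in> parcs G" for u v
  proof (rule ccontr)
    assume "v \<notin> W"
    moreover have "v \<in> pverts G" using that in_arcsD2 by blast
    ultimately have "P (insert v W)" using grow[of W u v] W that by auto
    then have "insert v W = W" using max[of "insert v W"] W \<open>v \<in> pverts G\<close> by auto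
    with \<open>v \<notin> W\<close> show False by auto
  qed
  then have "pverts G \<subseteq> W"
    using connected_adjacency_closed[OF assms(1-3)] W by blast
  with W show ?thesis by (metis subset_antisym)
qed

section \<open>Exchange of pegs and holes\<close>

text \<open>The same path \<open>x\<close>, \<open>y\<close>, \<open>z\<close>, in the same
  direction, serves the complements: \<open>x\<close> and \<open>y\<close> are emptied by the
  original jump, hence pegs of the complement of \<open>T\<close>, while \<open>z\<close> is a hole
  there.\<close>

lemma jump_complement:
  assumes "pair_wf_digraph G" "jump G S T" "S \<subseteq> pverts G"
  shows "jump G (pverts G - T) (pverts G - S)" "T \<subseteq> pverts G"
proof -
  interpret pair_wf_digraph G by fact
  obtain x y z where *: "distinct [x, y, z]" "(x, y) \<in> parcs G" "(y, z) \<in> parcs G"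
     "x \<in> S" "y \<in> S" "z \<notin> S" "T = insert z (S - {x, y})"
    using assms(2) unfolding jump_def by blast
  have "z \<in> pverts G" using * in_arcsD2 by blast
  then show "T \<subseteq> pverts G" using * assms(3) by blast
  show "jump G (pverts G - T) (pverts G - S)"
    unfolding jump_def
    by (rule exI[of _ x], rule exI[of _ y], rule exI[of _ z])
       (use * assms(3) \<open>z \<in> pverts G\<close> in auto)
qed

lemma jumps_complement:
  assumes "pair_wf_digraph G" "(jump G)\<^sup>*\<^sup>* S T" "S \<subseteq> pverts G"
  shows "(jump G)\<^sup>*\<^sup>* (pverts G - T) (pverts G - S) \<and> T \<subseteq> pverts G"
  using assms(2)
proof (induction rule: rtranclp_induct)
  case base
  then show ?case using assms(3) by simp
next
  case (step T U)
  then show ?case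
    using jump_complement[OF assms(1) step.hyps(2)]
    by (meson converse_rtranclp_into_rtranclp)
qed

text \<open>Every jump vacates its starting vertex, so the board is never full. This is what
  contradicts the propagation of pegs from two adjacent ones.\<close>

lemma jumps_from_one_hole:
  assumes "pair_wf_digraph G" "(jump G)\<^sup>*\<^sup>* (pverts G - {v}) T" "v \<in> pverts G"
  shows "T \<subset> pverts G"
  using assms(2)
proof (induction rule: rtranclp_induct)
  case base
  then show ?case using assms(3) by auto
next
  case (step T U)
  obtain x y z where *: "distinct [x, y, z]" "x \<in> T" "U = insert z (T - {x, y})"
    using step.hyps(2) unfolding jump_def by blast
  then have "x \<notin> U" "x \<in> pverts G" using step.IH by auto
  then show ?case
    using jump_complement(2)[OF assms(1) step.hyps(2)] step.IH by blast
qed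

section \<open>Independence of terminal states\<close>

lemma independent_imp_no_jump:
  "independent_set G S \<Longrightarrow> \<not> jump G S T"
  unfolding independent_set_def jump_def by blast

lemma terminal_imp_independent:
  assumes "pair_graph G" "connected (with_proj G)" "terminal_state G T"
  shows "independent_set G T"
proof (rule ccontr)
  interpret pair_graph G by fact
  have wf: "pair_wf_digraph G" by unfold_locales
  obtain v where v: "v \<in> pverts G" "(jump G)\<^sup>*\<^sup>* (pverts G - {v}) T"
    and stuck: "\<And>U. \<not> jump G T U"
    using assms(3) unfolding terminal_state_def by blast
  have T: "T \<subset> pverts G" using jumps_from_one_hole[OF wf v(2,1)] .
  assume "\<not> independent_set G T"
  then obtain x y where xy: "x \<in> T" "y \<in> T" "(x, y) \<in> parcs G"
    using T unfolding independent_set_def by blast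
  \<comment> \<open>The pegs with a neighbouring peg. If \<open>q\<close> is one, with neighbouring
    peg \<open>p\<close>, then a hole at a neighbour \<open>w\<close> of \<open>q\<close> would
    allow the jump \<open>p\<close>, \<open>q\<close>, \<open>w\<close>. Hence \<open>w\<close> is a
    peg next to the peg \<open>q\<close>, and \<open>X\<close> is closed under adjacency.\<close>
  define X where "X = {q \<in> T. \<exists>p\<in>T. (p, q) \<in> parcs G}"
  have "w \<in> X" if "q \<in> X" and qw: "(q, w) \<in> parcs G" for q w
  proof -
    obtain p where p: "p \<in> T" "q \<in> T" "(p, q) \<in> parcs G"
      using \<open>q \<in> X\<close> unfolding X_def by blast
    have "w \<in> T"
    proof (rule ccontr)
      assume "w \<notin> T"
      then have "jump G T (insert w (T - {p, q}))"
        unfolding jump_def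
        by (intro exI[of _ p] exI[of _ q] exI[of _ w])
           (use p qw pair_no_loops in fastforce)
      with stuck show False by blast
    qed
    with p qw show ?thesis unfolding X_def by blast
  qed
  moreover have "y \<in> X" "y \<in> pverts G" using xy T unfolding X_def by auto
  ultimately have "pverts G \<subseteq> X"
    using connected_adjacency_closed[OF assms(1,2)] by blast
  with T show False unfolding X_def by blast
qed

section \<open>Attainment of the independence and chromatic numbers\<close>

lemma finite_independent_cards:
  assumes "finite (pverts G)"
  shows "finite {card S | S. independent_set G S}"
  by (rule finite_subset[of _ "card ` Pow (pverts G)"])
     (use assms in \<open>auto simp: independent_set_def\<close>)

lemma independence_number_attained:
  assumes "finite (pverts G)"
  obtains S where "independent_set G S" "card S = independence_number G"
proof -
  have "independent_set G {}" by (simp add: independent_set_def)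
  then have "independence_number G \<in> {card S | S. independent_set G S}"
    unfolding independence_number_def
    by (intro Max_in finite_independent_cards assms) blast
  then show ?thesis using that by auto
qed

lemma card_le_independence_number:
  assumes "finite (pverts G)" "independent_set G S"
  shows "card S \<le> independence_number G"
  unfolding independence_number_def
  by (intro Max_ge finite_independent_cards assms) (use assms in blast)

lemma proper_coloring_chromatic_number:
  assumes "pair_graph G"
  shows "\<exists>c. proper_coloring G (chromatic_number G) c"
proof -
  interpret pair_graph G by fact
  \<comment> \<open>An injective numbering of the vertices is a proper coloring, since arcs join
    distinct vertices; so the \<open>LEAST\<close> ranges over a nonempty set.\<close>
  obtain c :: "'a \<Rightarrow> nat" and n where c: "c ` pverts G = {i. i < n}" "inj_on c (pverts G)"
    using finite_imp_inj_to_nat_seg[OF pair_finite_verts] by blast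
  have "proper_coloring G n c"
    unfolding proper_coloring_def
    using c in_arcsD1 in_arcsD2 pair_no_loops by (fastforce dest: inj_onD)
  then show ?thesis
    unfolding chromatic_number_def by (intro LeastI[of "\<lambda>n. \<exists>c. proper_coloring G n c"] exI)
qed

section \<open>Structure of the product with a complete graph\<close>

locale connected_times_complete = pair_graph G
  for G :: "'a pair_pre_digraph" +
  fixes K :: "'b pair_pre_digraph"
  assumes connected_G: "connected (with_proj G)"
    and finite_K: "finite (pverts K)"
    and card_K: "3 \<le> card (pverts K)"
    and parcs_K: "(x, y) \<in> parcs K \<longleftrightarrow> x \<in> pverts K \<and> y \<in> pverts K \<and> x \<noteq> y"
begin

lemma pverts_product: "pverts (G \<box> K) = pverts G \<times> pverts K"
  by (simp add: cartesian_product_def)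

lemma parcs_product:
  "((u, x), (v, y)) \<in> parcs (G \<box> K) \<longleftrightarrow>
     u = v \<and> u \<in> pverts G \<and> x \<in> pverts K \<and> y \<in> pverts K \<and> x \<noteq> y \<or>
     x = y \<and> x \<in> pverts K \<and> (u, v) \<in> parcs G"
  by (auto simp: cartesian_product_def parcs_K)

lemma edge_sym: "(u, v) \<in> parcs G \<Longrightarrow> (v, u) \<in> parcs G"
  using pair_sym_arcs by (auto simp: symmetric_def dest: symD)

lemma edge_neq: "(u, v) \<in> parcs G \<Longrightarrow> u \<noteq> v"
  using pair_no_loops by fastforce

lemma pair_graph_product: "pair_graph (G \<box> K)"
proof
  show "finite (pverts (G \<box> K))"
    by (simp add: pverts_product pair_finite_verts finite_K)
  then have "finite (pverts (G \<box> K) \<times> pverts (G \<box> K))" by simp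
  then show "finite (parcs (G \<box> K))"
    by (rule rev_finite_subset) (auto simp: pverts_product parcs_product dest: in_arcsD1 in_arcsD2)
  show "symmetric (with_proj (G \<box> K))"
    by (auto simp: symmetric_def parcs_product intro!: symI dest: edge_sym)
qed (auto simp: pverts_product parcs_product dest: in_arcsD1 in_arcsD2 edge_neq)

text \<open>A walk at fixed second coordinate reaches the right copy of \<open>K\<close>, and at
  most one arc inside that copy finishes.\<close>

lemma connected_product: "connected (with_proj (G \<box> K))"
proof -
  interpret P: pair_graph "G \<box> K" by (rule pair_graph_product)
  have row: "(u, x) \<rightarrow>\<^sup>*\<^bsub>with_proj (G \<box> K)\<^esub> (v, x)" if "u \<in> pverts G" "v \<in> pverts G" "x \<in> pverts K" for u v x
  proof -
    have "pverts G \<subseteq> {w. (u, x) \<rightarrow>\<^sup>*\<^bsub>with_proj (G \<box> K)\<^esub> (w, x)}"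
    proof (rule connected_adjacency_closed[OF _ connected_G that(1)])
      show "u \<in> {w. (u, x) \<rightarrow>\<^sup>*\<^bsub>with_proj (G \<box> K)\<^esub> (w, x)}"
        using that by (auto simp: pverts_product)
      fix w w' assume "w \<in> {w. (u, x) \<rightarrow>\<^sup>*\<^bsub>with_proj (G \<box> K)\<^esub> (w, x)}" "(w, w') \<in> parcs G"
      moreover from this have "((w, x), (w', x)) \<in> parcs (G \<box> K)"
        using that by (simp add: parcs_product)
      ultimately show "w' \<in> {w. (u, x) \<rightarrow>\<^sup>*\<^bsub>with_proj (G \<box> K)\<^esub> (w, x)}"
        by (auto intro: P.reachable_adj_trans)
    qed unfold_locales
    with that show ?thesis by auto
  qed
  have col: "(v, x) \<rightarrow>\<^sup>*\<^bsub>with_proj (G \<box> K)\<^esub> (v, y)" if "v \<in> pverts G" "x \<in> pverts K" "y \<in> pverts K" for v x y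
  proof (cases "x = y")
    case False
    then have "((v, x), (v, y)) \<in> parcs (G \<box> K)" using that by (simp add: parcs_product)
    then show ?thesis by auto
  qed (use that in \<open>auto simp: pverts_product\<close>)
  have "pverts G \<noteq> {}"
    using connected_G by (auto simp: connected_def strongly_connected_def)
  moreover have "pverts K \<noteq> {}" using card_K by auto
  ultimately have "strongly_connected (with_proj (G \<box> K))"
    by (intro strongly_connectedI) (auto simp: pverts_product intro: P.reachable_trans[OF row col])
  then show ?thesis
    using P.reachable_mk_symmetricI by (auto simp: connected_def strongly_connected_def)
qed

text \<open>A configuration is written as \<open>Sigma UNIV A\<close>, where \<open>A u\<close> is the set of pegs in the copy at \<open>u\<close>.\<close>

abbreviation reach :: "('a \<Rightarrow> 'b set) \<Rightarrow> ('a \<Rightarrow> 'b set) \<Rightarrow> bool" where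
  "reach A A' \<equiv> (jump (G \<box> K))\<^sup>*\<^sup>* (Sigma UNIV A) (Sigma UNIV A')"

section \<open>Moves on the copies of the complete graph\<close>

text \<open>The peg \<open>(u, a)\<close> jumps over \<open>(v, a)\<close> into
  \<open>(v, b)\<close>. When \<open>b\<close> is the sole hole of the copy at \<open>v\<close>, the
  effect is to delete \<open>a\<close> from the copy at \<open>u\<close> and to move that hole from
  \<open>b\<close> to \<open>a\<close>.\<close>

lemma jump_across:
  assumes "(u, v) \<in> parcs G" "a \<in> A u" "a \<in> A v" "b \<notin> A v" "a \<in> pverts K" "b \<in> pverts K"
  shows "reach A (A(u := A u - {a}, v := insert b (A v - {a})))"
proof -
  have "u \<noteq> v" using assms edge_neq by blast
  moreover have "v \<in> pverts G" using assms(1) in_arcsD2 by blast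
  ultimately have "jump (G \<box> K) (Sigma UNIV A)
      (Sigma UNIV (A(u := A u - {a}, v := insert b (A v - {a}))))"
    unfolding jump_def
    by (intro exI[of _ "(u, a)"] exI[of _ "(v, a)"] exI[of _ "(v, b)"])
       (use assms in \<open>auto simp: parcs_product split: if_splits\<close>)
  then show ?thesis by blast
qed

lemma jump_within:
  assumes "v \<in> pverts G" "a \<in> A v" "c \<in> A v" "b \<notin> A v" "a \<noteq> c"
    "a \<in> pverts K" "b \<in> pverts K" "c \<in> pverts K"
  shows "reach A (A(v := insert b (A v - {a, c})))"
proof -
  have "jump (G \<box> K) (Sigma UNIV A) (Sigma UNIV (A(v := insert b (A v - {a, c}))))"
    unfolding jump_def
    by (intro exI[of _ "(v, a)"] exI[of _ "(v, c)"] exI[of _ "(v, b)"])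
       (use assms in \<open>auto simp: parcs_product split: if_splits\<close>)
  then show ?thesis by blast
qed

text \<open>A peg \<open>a\<close> at \<open>u\<close> can jump across unless \<open>a = b\<close>,
  so the only obstruction is a lone peg facing the hole at \<open>v\<close>. A jump with
  \<open>a\<close> moves the hole to \<open>a\<close>, where the copy at \<open>u\<close> has no peg
  any more, so the obstruction cannot arise later.\<close>

lemma clear_copy:
  assumes "(u, v) \<in> parcs G" "U \<subseteq> pverts K" "b \<in> pverts K" "U \<noteq> {b}"
    "A u = U" "A v = pverts K - {b}"
  shows "\<exists>b'\<in>pverts K. reach A (A(u := {}, v := pverts K - {b'}))"
proof -
  have "finite U" using assms(2) finite_K finite_subset by blast
  then show ?thesis using assms
  proof (induction "card U" arbitrary: U A b)
    case 0
    then have "A(u := {}, v := pverts K - {b}) = A" by (auto simp: fun_eq_iff)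
    then show ?case using 0 by (metis rtranclp.rtrancl_refl)
  next
    case (Suc n)
    then have "U \<noteq> {}" by auto
    with Suc.prems obtain a where a: "a \<in> U" "a \<noteq> b" by blast
    have uv: "u \<noteq> v" using edge_neq Suc.prems by blast
    let ?A = "A(u := U - {a}, v := pverts K - {a})"
    have "insert b (pverts K - {b} - {a}) = pverts K - {a}" using a Suc.prems by auto
    then have r: "reach A ?A"
      using jump_across[of u v a A b] a Suc.prems by auto
    \<comment> \<open>The side condition for the next round is \<open>U - {a} \<noteq> {a}\<close>,
      which always holds.\<close>
    have "\<exists>b'\<in>pverts K. reach ?A (?A(u := {}, v := pverts K - {b'}))"
      by (rule Suc.hyps(1)[of "U - {a}" a]) (use Suc.hyps(2) Suc.prems a uv in auto)
    then obtain b' where b': "b' \<in> pverts K" "reach ?A (?A(u := {}, v := pverts K - {b'}))" by blast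
    moreover have "?A(u := {}, v := pverts K - {b'}) = A(u := {}, v := pverts K - {b'})"
      by (auto simp: fun_eq_iff)
    ultimately show ?case using r by (metis rtranclp_trans)
  qed
qed

text \<open>Any two pegs and a hole of one copy form a path, so a jump inside the copy lowers its
  number of pegs by one. The vacated vertices keep the peg set a proper subset, which provides the
  next hole.\<close>

lemma reduce_copy:
  assumes "v \<in> pverts G" "A v \<subset> pverts K" "A v \<noteq> {}"
  shows "\<exists>x\<in>pverts K. reach A (A(v := {x}))"
  using assms(2,3)
proof (induction "card (A v)" arbitrary: A rule: less_induct)
  case less
  have fin: "finite (A v)" using less.prems finite_K finite_subset by blast
  obtain a where a: "a \<in> A v" using less.prems by blast
  show ?case
  proof (cases "A v = {a}")
    case True
    then have "A(v := {a}) = A" by (metis fun_upd_triv)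
    then show ?thesis using a less.prems by (intro bexI[of _ a]) auto
  next
    case False
    then obtain c where c: "c \<in> A v" "c \<noteq> a" using a by blast
    obtain b where b: "b \<in> pverts K" "b \<notin> A v" using less.prems by blast
    let ?A = "A(v := insert b (A v - {a, c}))"
    have r: "reach A ?A" using jump_within[of v a A c b] a b c less.prems assms(1) by auto
    have "card (A v) \<ge> 2"
      using card_mono[OF fin, of "{a, c}"] a c by auto
    moreover have "card (A v - {a, c}) = card (A v) - 2"
      using a c by (subst card_Diff_subset) auto
    ultimately have "card (?A v) < card (A v)"
      using fin b by simp
    moreover have "?A v \<subset> pverts K" "?A v \<noteq> {}" using a b c less.prems by auto
    ultimately obtain x where "x \<in> pverts K" "reach ?A (?A(v := {x}))"
      using less.hyps[of ?A] by blast
    then show ?thesis using r by (metis (no_types, lifting) fun_upd_upd rtranclp_trans)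
  qed
qed

section \<open>Solving the complement of an independent set\<close>

lemma spread_holes:
  assumes "r \<in> pverts G"
    and "\<And>u. u \<in> pverts G \<Longrightarrow> A u = pverts K \<or> (\<exists>b\<in>pverts K. A u = pverts K - {b})"
    and "\<And>u. u \<notin> pverts G \<Longrightarrow> A u = {}"
    and "A r \<noteq> pverts K"
  shows "\<exists>h. (\<forall>u\<in>pverts G. h u \<in> pverts K) \<and>
    reach A (\<lambda>u. if u \<in> pverts G then pverts K - {h u} else {})"
proof -
  \<comment> \<open>Copies over \<open>W\<close> have exactly one hole; those outside may already
    have one or still be full. The value \<open>{}\<close> off V(G) is carried along so that the
    final position is determined as a function on the whole type.\<close>
  define inv where "inv W \<longleftrightarrow> (\<exists>A'. reach A A' \<and> (\<forall>u. u \<notin> pverts G \<longrightarrow> A' u = {}) \<and>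
      (\<forall>u\<in>pverts G. A' u = pverts K \<or> (\<exists>b\<in>pverts K. A' u = pverts K - {b})) \<and>
      (\<forall>u\<in>W. \<exists>b\<in>pverts K. A' u = pverts K - {b}))" for W
  have "inv (pverts G)"
    using pair_graph_axioms connected_G assms(1)
  proof (induction rule: connected_growth_induct)
    case root
    have "\<exists>b\<in>pverts K. A r = pverts K - {b}" using assms(1,4) assms(2)[of r] by blast
    then show ?case unfolding inv_def using assms(2,3) by (intro exI[of _ A]) simp
  next
    case (grow W u v)
    then obtain A' where A': "reach A A'" "\<forall>u. u \<notin> pverts G \<longrightarrow> A' u = {}"
      "\<forall>u\<in>pverts G. A' u = pverts K \<or> (\<exists>b\<in>pverts K. A' u = pverts K - {b})"
      "\<forall>u\<in>W. \<exists>b\<in>pverts K. A' u = pverts K - {b}" unfolding inv_def by blast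
    have "\<exists>A'. reach A A' \<and> (\<forall>u. u \<notin> pverts G \<longrightarrow> A' u = {}) \<and>
      (\<forall>u\<in>pverts G. A' u = pverts K \<or> (\<exists>b\<in>pverts K. A' u = pverts K - {b})) \<and>
      (\<forall>w\<in>insert u W. \<exists>b\<in>pverts K. A' w = pverts K - {b})"
    proof (cases "A' u = pverts K")
      case False
      then show ?thesis using A' grow by (intro exI[of _ A']) auto
    next
      case True
      obtain b where b: "b \<in> pverts K" "A' v = pverts K - {b}" using A' grow by blast
      have "pverts K \<noteq> {b}" using card_K by auto
      then obtain a where a: "a \<in> pverts K" "a \<noteq> b" using b by blast
      \<comment> \<open>One jump gives the full copy at \<open>u\<close> a hole at \<open>a\<close>
        and moves the hole at \<open>v\<close> from \<open>b\<close> to \<open>a\<close>, so both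
        copies end with exactly one hole.\<close>
      let ?A = "A'(u := pverts K - {a}, v := pverts K - {a})"
      have "insert b (pverts K - {b} - {a}) = pverts K - {a}" using a b by auto
      then have "reach A' ?A"
        using jump_across[of u v a A' b] a b True grow edge_sym by auto
      then have "reach A ?A" using A'(1) by (metis rtranclp_trans)
      moreover have "v \<in> pverts G" using grow by blast
      ultimately show ?thesis using A' a grow by (intro exI[of _ ?A]) auto
    qed
    then show ?case unfolding inv_def .
  qed
  then obtain A' where A': "reach A A'" "\<forall>u. u \<notin> pverts G \<longrightarrow> A' u = {}"
      "\<forall>u\<in>pverts G. \<exists>b\<in>pverts K. A' u = pverts K - {b}" unfolding inv_def by blast
  then obtain h where h: "\<forall>u\<in>pverts G. h u \<in> pverts K \<and> A' u = pverts K - {h u}" by metis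
  then have "A' = (\<lambda>u. if u \<in> pverts G then pverts K - {h u} else {})"
    using A'(2) by (simp add: fun_eq_iff)
  then have "reach A (\<lambda>u. if u \<in> pverts G then pverts K - {h u} else {})"
    using A'(1) by (simp only:)
  with h show ?thesis by blast
qed

lemma one_hole_per_copy_solvable:
  assumes "\<And>u. u \<in> pverts G \<Longrightarrow> h u \<in> pverts K"
  shows "\<exists>p\<in>pverts (G \<box> K). (jump (G \<box> K))\<^sup>*\<^sup>*
           (Sigma UNIV (\<lambda>u. if u \<in> pverts G then pverts K - {h u} else {})) {p}"
proof -
  obtain r where r: "r \<in> pverts G"
    using connected_G by (auto simp: connected_def strongly_connected_def)
  \<comment> \<open>The hole positions \<open>h\<close> are quantified inside, because emptying the
    copy at \<open>u\<close> changes the hole of its neighbour at \<open>v\<close> before the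
    hypothesis for \<open>W\<close> is applied. Copies are thus emptied in the reverse of the order
    in which \<open>W\<close> grows.\<close>
  define solvable where "solvable W \<longleftrightarrow> (\<forall>h. (\<forall>u\<in>W. h u \<in> pverts K) \<longrightarrow>
      (\<exists>p\<in>pverts (G \<box> K). (jump (G \<box> K))\<^sup>*\<^sup>*
           (Sigma UNIV (\<lambda>u. if u \<in> W then pverts K - {h u} else {})) {p}))" for W
  have "solvable (pverts G)"
    using pair_graph_axioms connected_G r
  proof (induction rule: connected_growth_induct)
    case root
    show ?case unfolding solvable_def
    proof (intro allI impI)
      fix h assume h: "\<forall>u\<in>{r}. h u \<in> pverts K"
      let ?A = "\<lambda>u. if u \<in> {r} then pverts K - {h u} else {}"
      have "card (pverts K - {h r}) \<ge> 2" using h finite_K card_K by auto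
      then have "pverts K - {h r} \<noteq> {}" by (metis card.empty not_numeral_le_zero)
      then have "?A r \<noteq> {}" "?A r \<subset> pverts K" using h by auto
      then obtain x where x: "x \<in> pverts K" "reach ?A (?A(r := {x}))"
        using reduce_copy[OF r, of ?A] by blast
      have "?A(r := {x}) = (\<lambda>u. if u = r then {x} else {})" by (simp add: fun_eq_iff)
      moreover have "Sigma UNIV (\<lambda>u. if u = r then {x} else {}) = {(r, x)}"
        by (auto split: if_splits)
      ultimately have "(jump (G \<box> K))\<^sup>*\<^sup>* (Sigma UNIV ?A) {(r, x)}" using x(2) by (simp only:)
      moreover have "(r, x) \<in> pverts (G \<box> K)" using r x(1) by (simp add: pverts_product)
      ultimately show "\<exists>p\<in>pverts (G \<box> K). (jump (G \<box> K))\<^sup>*\<^sup>* (Sigma UNIV ?A) {p}"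
        by blast
    qed
  next
    case (grow W u v)
    show ?case unfolding solvable_def
    proof (intro allI impI)
      fix h assume h: "\<forall>u\<in>insert u W. h u \<in> pverts K"
      let ?A = "\<lambda>w. if w \<in> insert u W then pverts K - {h w} else {}"
      have "h u \<in> pverts K" using h by blast
      \<comment> \<open>With at least three vertices in \<open>K\<close>, the copy at
        \<open>u\<close> has at least two pegs, which rules out the lone blocked peg excluded in
        \<open>clear_copy\<close>.\<close>
      then have "card (pverts K - {h u}) = card (pverts K) - 1" by (rule card_Diff_singleton)
      then have "card (pverts K - {h u}) \<ge> 2" using card_K by linarith
      then have "card (pverts K - {h u}) \<noteq> card {h v}" by simp
      then have "pverts K - {h u} \<noteq> {h v}" by metis
      moreover have "(u, v) \<in> parcs G" "h v \<in> pverts K" "?A u = pverts K - {h u}"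
          "?A v = pverts K - {h v}" "pverts K - {h u} \<subseteq> pverts K"
        using grow.hyps h edge_sym by auto
      ultimately obtain b where b: "b \<in> pverts K" "reach ?A (?A(u := {}, v := pverts K - {b}))"
        using clear_copy[of u v "pverts K - {h u}" "h v" ?A] by blast
      let ?h = "h(v := b)"
      have "?A(u := {}, v := pverts K - {b}) = (\<lambda>w. if w \<in> W then pverts K - {?h w} else {})"
        using grow.hyps by (auto simp: fun_eq_iff)
      moreover have "\<forall>w\<in>W. ?h w \<in> pverts K" using h b(1) by simp
      then obtain p where "p \<in> pverts (G \<box> K)" "(jump (G \<box> K))\<^sup>*\<^sup>*
          (Sigma UNIV (\<lambda>w. if w \<in> W then pverts K - {?h w} else {})) {p}"
        using grow.IH unfolding solvable_def by blast
      ultimately show "\<exists>p\<in>pverts (G \<box> K). (jump (G \<box> K))\<^sup>*\<^sup>* (Sigma UNIV ?A) {p}"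
        using b(2) by (metis (no_types, lifting) rtranclp_trans)
    qed
  qed
  then show ?thesis using assms unfolding solvable_def by blast
qed

section \<open>Independent sets as terminal states\<close>

lemma independent_copy_unique:
  assumes "independent_set (G \<box> K) S" "(u, x) \<in> S" "(u, y) \<in> S"
  shows "x = y"
proof (rule ccontr)
  assume "x \<noteq> y"
  moreover have "(u, x) \<in> pverts (G \<box> K)" "(u, y) \<in> pverts (G \<box> K)"
    using assms unfolding independent_set_def by blast+
  ultimately have "((u, x), (u, y)) \<in> parcs (G \<box> K)"
    by (simp add: parcs_product pverts_product)
  with assms show False unfolding independent_set_def by blast
qed

lemma independent_imp_terminal:
  assumes S: "independent_set (G \<box> K) S" and "S \<noteq> {}"
  shows "terminal_state (G \<box> K) S"
proof -
  interpret P: pair_graph "G \<box> K" by (rule pair_graph_product)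
  have wf: "pair_wf_digraph (G \<box> K)" by unfold_locales
  have sub: "S \<subseteq> pverts G \<times> pverts K"
    using S by (simp add: independent_set_def pverts_product)
  have unique: "x = y" if "(u, x) \<in> S" "(u, y) \<in> S" for u x y
    using independent_copy_unique[OF S] that by blast
  \<comment> \<open>The pegs of the complement of \<open>S\<close>, copy by copy. By independence
    each copy has at most one hole, and the copy at \<open>r\<close> has one because
    \<open>S\<close> is nonempty; that hole is where \<open>spread_holes\<close> starts.\<close>
  define A where "A u = (if u \<in> pverts G then {x \<in> pverts K. (u, x) \<notin> S} else {})" for u
  have compl: "pverts (G \<box> K) - S = Sigma UNIV A"
    by (auto simp: pverts_product A_def split: if_splits)
  obtain r x where rx: "(r, x) \<in> S" using assms(2) by auto
  have "\<exists>h. (\<forall>u\<in>pverts G. h u \<in> pverts K) \<and>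
    reach A (\<lambda>u. if u \<in> pverts G then pverts K - {h u} else {})"
  proof (rule spread_holes)
    show "r \<in> pverts G" "A r \<noteq> pverts K" using rx sub by (auto simp: A_def)
    show "A u = {}" if "u \<notin> pverts G" for u using that by (simp add: A_def)
    show "A u = pverts K \<or> (\<exists>b\<in>pverts K. A u = pverts K - {b})" if "u \<in> pverts G" for u
    proof (cases "\<exists>b. (u, b) \<in> S")
      case True
      then obtain b where "(u, b) \<in> S" by blast
      moreover from this have "A u = pverts K - {b}"
        using that unique by (auto simp: A_def)
      ultimately show ?thesis using sub by auto
    qed (use that in \<open>auto simp: A_def\<close>)
  qed
  then obtain h where h: "\<And>u. u \<in> pverts G \<Longrightarrow> h u \<in> pverts K"
    "reach A (\<lambda>u. if u \<in> pverts G then pverts K - {h u} else {})" by blast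
  obtain p where p: "p \<in> pverts (G \<box> K)"
    "(jump (G \<box> K))\<^sup>*\<^sup>* (pverts (G \<box> K) - S) {p}"
    using one_hole_per_copy_solvable[of h, OF h(1)] h(2) unfolding compl
    by (blast intro: rtranclp_trans)
  \<comment> \<open>Complementing the play from the complement of \<open>S\<close> to
    \<open>{p}\<close> yields a play from a single hole at \<open>p\<close> to
    \<open>S\<close>.\<close>
  then have "(jump (G \<box> K))\<^sup>*\<^sup>* (pverts (G \<box> K) - {p}) (pverts (G \<box> K) - (pverts (G \<box> K) - S))"
    using jumps_complement[OF wf] by blast
  moreover have "pverts (G \<box> K) - (pverts (G \<box> K) - S) = S"
    using sub by (auto simp: pverts_product)
  ultimately show ?thesis
    using p(1) independent_imp_no_jump[OF S] unfolding terminal_state_def by auto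
qed

section \<open>The fool's solitaire number and its value for large \<open>k\<close>\<close>

lemma fools_solitaire_product:
  "fools_solitaire_number (G \<box> K) = independence_number (G \<box> K)"
proof -
  interpret P: pair_graph "G \<box> K" by (rule pair_graph_product)
  have terminal: "terminal_state (G \<box> K) T \<Longrightarrow> independent_set (G \<box> K) T" for T
    by (rule terminal_imp_independent[OF pair_graph_product connected_product])
  obtain S where S: "independent_set (G \<box> K) S" "card S = independence_number (G \<box> K)"
    using independence_number_attained[OF P.pair_finite_verts] .
  obtain p where "p \<in> pverts (G \<box> K)"
    using connected_product by (auto simp: connected_def strongly_connected_def)
  \<comment> \<open>A singleton is independent, so the independence number is at least 1 and the
    maximum set \<open>S\<close> is nonempty, as \<open>independent_imp_terminal\<close>
    demands.\<close>
  then have "independent_set (G \<box> K) {p}"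
    using P.pair_no_loops by (fastforce simp: independent_set_def)
  then have "card S \<ge> 1"
    using card_le_independence_number[OF P.pair_finite_verts] S(2) by fastforce
  then have "S \<noteq> {}" by auto
  then have "terminal_state (G \<box> K) S" by (rule independent_imp_terminal[OF S(1)])
  show ?thesis
    unfolding fools_solitaire_number_def
  proof (rule Max_eqI)
    show "finite {card T | T. terminal_state (G \<box> K) T}"
      by (rule finite_subset[OF _ finite_independent_cards[OF P.pair_finite_verts]])
         (use terminal in blast)
    show "independence_number (G \<box> K) \<in> {card T | T. terminal_state (G \<box> K) T}"
      using \<open>terminal_state (G \<box> K) S\<close> S(2) by force
    show "n \<le> independence_number (G \<box> K)" if "n \<in> {card T | T. terminal_state (G \<box> K) T}" for n
      using that terminal card_le_independence_number[OF P.pair_finite_verts] by auto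
  qed
qed

text \<open>An independent set meets each copy of \<open>K\<close> at most once, so the projection
  to \<open>G\<close> is injective on it. Conversely, the graph of a proper coloring with values in
  \<open>K\<close> is independent: it has one vertex per copy, and adjacent vertices of
  \<open>G\<close> get different second coordinates.\<close>

lemma independence_number_product:
  assumes "chromatic_number G \<le> card (pverts K)"
  shows "independence_number (G \<box> K) = card (pverts G)"
proof (rule antisym)
  interpret P: pair_graph "G \<box> K" by (rule pair_graph_product)
  obtain S where S: "independent_set (G \<box> K) S" "card S = independence_number (G \<box> K)"
    using independence_number_attained[OF P.pair_finite_verts] .
  have sub: "S \<subseteq> pverts G \<times> pverts K"
    using S by (simp add: independent_set_def pverts_product)
  have "inj_on fst S"
    using independent_copy_unique[OF S(1)] by (auto simp: inj_on_def)
  moreover have "fst ` S \<subseteq> pverts G" using sub by auto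
  ultimately have "card S \<le> card (pverts G)"
    using pair_finite_verts by (rule card_inj_on_le)
  then show "independence_number (G \<box> K) \<le> card (pverts G)" using S(2) by simp
  obtain c where c: "proper_coloring G (chromatic_number G) c"
    using proper_coloring_chromatic_number[OF pair_graph_axioms] by blast
  \<comment> \<open>\<open>f\<close> renames the colors as vertices of \<open>K\<close>; the bound
    on the chromatic number places all colors in its domain, where \<open>f\<close> is
    injective.\<close>
  obtain f where f: "bij_betw f {0..<card (pverts K)} (pverts K)"
    using ex_bij_betw_nat_finite[OF finite_K] by blast
  have cl: "c u \<in> {0..<card (pverts K)}" if "u \<in> pverts G" for u
    using c assms that by (fastforce simp: proper_coloring_def)
  have neq: "f (c u) \<noteq> f (c v)" if "(u, v) \<in> parcs G" for u v
  proof -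
    have "c u \<noteq> c v" using c that by (auto simp: proper_coloring_def)
    then show ?thesis
      using f cl in_arcsD1[OF that] in_arcsD2[OF that]
      by (auto simp: bij_betw_def dest: inj_onD)
  qed
  let ?T = "(\<lambda>u. (u, f (c u))) ` pverts G"
  have "f (c u) \<in> pverts K" if "u \<in> pverts G" for u
    using f cl[OF that] by (rule bij_betwE[rule_format])
  then have "independent_set (G \<box> K) ?T"
    using neq by (auto simp: independent_set_def pverts_product parcs_product)
  moreover have "card ?T = card (pverts G)" by (rule card_image) (auto simp: inj_on_def)
  ultimately show "card (pverts G) \<le> independence_number (G \<box> K)"
    using card_le_independence_number[OF P.pair_finite_verts] by metis
qed

end

theorem theorem3p4:
  fixes G :: "'a pair_pre_digraph" and K :: "'b pair_pre_digraph" and k :: nat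
  assumes "pair_graph G" and "connected (with_proj G)"
    and "k \<ge> 3" and "K\<^bsub>k\<^esub> (with_proj K)"
  shows "fools_solitaire_number (G \<box> K) = independence_number (G \<box> K) \<and>
    (k \<ge> chromatic_number G \<longrightarrow> fools_solitaire_number (G \<box> K) = card (pverts G))"
proof -
  have K: "finite (pverts K)" "card (pverts K) = k"
    "parcs K = {(u, v). (u, v) \<in> pverts K \<times> pverts K \<and> u \<noteq> v}"
    using assms(4) by (simp_all add: complete_digraph_pair_def)
  interpret pair_graph G by fact
  interpret connected_times_complete G K
    by unfold_locales (use assms K in auto)
  show ?thesis
    using fools_solitaire_product independence_number_product K(2) by auto
qed

end
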